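(* Let $q=p^{e}$ with $p$ an odd prime and $e\ge 1$, and let $l$ be an integer with $0\leq l\leq e-1$ and $2l\mid e$. Let $x_1,x_2$ be positive integers with $(q-1)\mid \mathrm{lcm}(x_{1},x_{2})$ and $\frac{q-1}{p^{l}-1}\mid x_{1}$. Let $n=\frac{r(q-1)}{\gcd(x_{2},q-1)}$, where $r$ is an integer with $1\leq r\leq \frac{q-1}{\gcd(x_{1},q-1)}$. Then for any integer $k$ with $1\leq k\leq \left\lfloor\frac{p^{l}+n}{p^{l}+1}\right\rfloor$: (1) there exists an $[n,k]_{q}$ MDS code $\mathcal{C}$ with $h$-dimensional $l$-Galois hull, for any integer $0\leq h\leq k-1$; (2) there exists an $[n+1,k]_{q}$ MDS code $\mathcal{C}$ with $h$-dimensional $l$-Galois hull, for any integer $0\leq h\leq k$; (3) there exists an $[n+2,k]_{q}$ MDS code $\mathcal{C}$ with $h$-dimensional $l$-Galois hull, for any integer $0\leq h\leq k-1$.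
   Context: An $[N,k]_q$ code is a $k$-dimensional linear subspace $\mathcal{C}$ of $\mathbb{F}_q^N$; it is MDS if its minimum Hamming distance equals $N-k+1$. For $\mathbf{x},\mathbf{y}\in\mathbb{F}_q^N$ with $q=p^e$, the $l$-Galois form is $(\mathbf{x},\mathbf{y})_l=\sum_{i=1}^N x_i y_i^{p^l}$. The $l$-Galois dual of $\mathcal{C}$ is $\mathcal{C}^{\perp_l}=\{\mathbf{x}\in\mathbb{F}_q^N : (\mathbf{y},\mathbf{x})_l=0 \text{ for all } \mathbf{y}\in\mathcal{C}\}$, and the $l$-Galois hull is $Hull_l(\mathcal{C})=\mathcal{C}\cap\mathcal{C}^{\perp_l}$; "with $h$-dimensional $l$-Galois hull" means $\dim_{\mathbb{F}_q}Hull_l(\mathcal{C})=h$. *)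

theory Defs
  imports "Jordan_Normal_Form.VS_Connect" "HOL-Computational_Algebra.Primes"
begin

text \<open>
  The field with \<open>q\<close> elements is an arbitrary type \<open>'a\<close> of classes \<open>finite\<close> and \<open>field\<close>;
  the space of words of length \<open>N\<close> over it is the vector space \<open>module_vec TYPE('a) N\<close>, with
  carrier \<open>carrier_vec N\<close> and coordinates indexed from 0.
\<close>

text \<open>Meaningful only when \<open>C\<close> is a subspace.\<close>

definition dim_in :: "nat \<Rightarrow> 'a::field vec set \<Rightarrow> nat" where
  "dim_in N C = vectorspace.dim class_ring ((module_vec TYPE('a) N)\<lparr>carrier := C\<rparr>)"

definition linear_code :: "nat \<Rightarrow> nat \<Rightarrow> 'a::field vec set \<Rightarrow> bool" where
  "linear_code N k C \<longleftrightarrow>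
     VectorSpace.subspace class_ring C (module_vec TYPE('a) N) \<and> dim_in N C = k"

definition hamming_dist :: "'a vec \<Rightarrow> 'a vec \<Rightarrow> nat" where
  "hamming_dist x y = card {i. i < dim_vec x \<and> x $ i \<noteq> y $ i}"

text \<open>Meaningful only when \<open>C\<close> contains two distinct words, so not for the zero code.\<close>

definition min_dist :: "'a vec set \<Rightarrow> nat" where
  "min_dist C = Min {hamming_dist x y | x y. x \<in> C \<and> y \<in> C \<and> x \<noteq> y}"

text \<open>Every \<open>k\<close>-dimensional code of length \<open>N\<close> has \<open>k \<le> N\<close>, so the subtraction is not truncated.\<close>

definition MDS_code :: "nat \<Rightarrow> nat \<Rightarrow> 'a::field vec set \<Rightarrow> bool" where
  "MDS_code N k C \<longleftrightarrow> linear_code N k C \<and> min_dist C = N - k + 1"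

text \<open>Below, \<open>p\<close> is meant to be the characteristic of the field.\<close>

definition galois_form :: "nat \<Rightarrow> nat \<Rightarrow> 'a::field vec \<Rightarrow> 'a vec \<Rightarrow> 'a" where
  "galois_form p l x y = (\<Sum>i<dim_vec x. x $ i * (y $ i) ^ (p ^ l))"

definition galois_dual :: "nat \<Rightarrow> nat \<Rightarrow> nat \<Rightarrow> 'a::field vec set \<Rightarrow> 'a vec set" where
  "galois_dual p l N C = {x \<in> carrier_vec N. \<forall>y\<in>C. galois_form p l y x = 0}"

definition galois_hull :: "nat \<Rightarrow> nat \<Rightarrow> nat \<Rightarrow> 'a::field vec set \<Rightarrow> 'a vec set" where
  "galois_hull p l N C = C \<inter> galois_dual p l N C"

end

theory Submission
  imports Defs
begin

text \<open>
  Put \<open>Q = p\<^sup>l\<close>. The numbers \<open>m = (q - 1) / gcd(x\<^sub>2, q - 1)\<close> and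
  \<open>o\<^sub>1 = (q - 1) / gcd(x\<^sub>1, q - 1)\<close> are coprime, and \<open>o\<^sub>1\<close> divides \<open>Q - 1\<close>. Choose
  a set \<open>Y\<close> of \<open>r\<close> roots of unity of order dividing \<open>o\<^sub>1\<close>; they lie in the subfield with \<open>Q\<close>
  elements and each of them has exactly \<open>m\<close> different \<open>m\<close>-th roots. So \<open>A = {a. a\<^sup>m \<in> Y}\<close> has
  \<open>n\<close> elements, and \<open>x \<Prod>\<^sub>y (x\<^sup>m - y)\<close> is the monic polynomial with the simple roots
  \<open>B = A \<union> {0}\<close>. Its derivative takes values in the subfield at the points of \<open>B\<close>; as \<open>2l\<close> divides
  \<open>e\<close>, the norm is surjective onto the subfield, so the inverse \<open>U\<^sub>b\<close> of the derivative at \<open>b\<close>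
  and also \<open>- U\<^sub>b\<close> have the form \<open>w\<^sup>Q\<^sup>+\<^sup>1\<close>. By Lagrange interpolation,
  \<open>\<Sum>\<^sub>b U\<^sub>b F(b) = 0\<close> whenever the degree of \<open>F\<close> is less than \<open>n\<close>, in particular for
  \<open>F = g f\<^sup>Q\<close> with \<open>f\<close>, \<open>g\<close> of degree less than \<open>k\<close>.

  Evaluate such polynomials on \<open>A\<close>, on \<open>B\<close> or on \<open>B \<union> {\<infinity>}\<close> with these
  multipliers \<open>w\<close>, taking the sign \<open>-\<close> at a set \<open>S\<close> of points. Subtracting the vanishing sum leaves
  a diagonal form supported on a set \<open>X\<close>, which consists of \<open>S\<close> and of the point by which the
  evaluation set differs from \<open>B\<close>, so the hull consists of the polynomials that vanish on \<open>X\<close>. It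
  has dimension \<open>k - |X|\<close>.
\<close>

subsection \<open>Generalized Reed-Solomon codes\<close>

text \<open>Stated through coefficients so that the zero polynomial belongs for every
  \<open>d\<close>, even \<open>d = 0\<close>, where \<open>degree f < d\<close> fails.\<close>

definition polys_below :: "nat \<Rightarrow> 'a::zero poly set" where
  "polys_below d = {f. \<forall>i\<ge>d. coeff f i = 0}"

text \<open>Reading a vector of length \<open>d\<close> as a coefficient list turns \<open>T\<close>
  into an injective linear map, so rank-nullity gives dimension \<open>d\<close>. This serves both
  for the code and for its hull.\<close>

lemma linear_code_image_polys_below:
  fixes T :: "'a::field poly \<Rightarrow> 'a vec"
  assumes lin: "\<And>f g. T (f + g) = T f + T g" "\<And>c f. T (Polynomial.smult c f) = c \<cdot>\<^sub>v T f"
    and car: "\<And>f. T f \<in> carrier_vec N"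
    and inj: "\<And>f. f \<in> polys_below d \<Longrightarrow> T f = 0\<^sub>v N \<Longrightarrow> f = 0"
  shows "linear_code N d (T ` polys_below d)"
proof -
  interpret V: vec_space "TYPE('a)" d .
  interpret W: vec_space "TYPE('a)" N .
  define \<phi> where "\<phi> x = T (Poly (list_of_vec x))" for x :: "'a vec"
  let ?C = "T ` polys_below d"
  have coeff: "coeff (Poly (list_of_vec x)) i = (if i < d then x $ i else 0)"
    if "x \<in> carrier_vec d" for x :: "'a vec" and i
    using that by (auto simp: nth_default_def list_of_vec_index)
  have \<phi>_car: "\<phi> x \<in> carrier_vec N" for x by (simp add: \<phi>_def car)
  have add: "\<phi> (x + y) = \<phi> x + \<phi> y" if "x \<in> carrier_vec d" "y \<in> carrier_vec d" for x y
  proof -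
    have "Poly (list_of_vec (x + y)) = Poly (list_of_vec x) + Poly (list_of_vec y)"
      using that by (intro poly_eqI) (simp add: coeff del: coeff_Poly_eq)
    thus ?thesis by (simp add: \<phi>_def lin)
  qed
  have smult: "\<phi> (c \<cdot>\<^sub>v x) = c \<cdot>\<^sub>v \<phi> x" if "x \<in> carrier_vec d" for c x
  proof -
    have "Poly (list_of_vec (c \<cdot>\<^sub>v x)) = Polynomial.smult c (Poly (list_of_vec x))"
      using that by (intro poly_eqI) (simp add: coeff del: coeff_Poly_eq)
    thus ?thesis by (simp add: \<phi>_def lin)
  qed
  have image: "\<phi> ` carrier_vec d = ?C"
  proof (intro equalityI subsetI)
    fix y assume "y \<in> \<phi> ` carrier_vec d"
    thus "y \<in> ?C" by (auto simp: \<phi>_def polys_below_def coeff simp del: coeff_Poly_eq)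
  next
    fix y assume "y \<in> ?C"
    then obtain f where f: "f \<in> polys_below d" "y = T f" by auto
    have "f = Poly (list_of_vec (vec d (coeff f)))"
      using f by (intro poly_eqI) (subst coeff, auto simp: polys_below_def)
    hence "y = \<phi> (vec d (coeff f))" by (simp add: \<phi>_def f)
    thus "y \<in> \<phi> ` carrier_vec d" by auto
  qed
  have "mod_hom class_ring (module_vec TYPE('a) d) (module_vec TYPE('a) N) \<phi>"
    unfolding mod_hom_def mod_hom_axioms_def LinearCombinations.module_hom_def
    using V.module_axioms W.module_axioms
    by (auto simp: add smult \<phi>_car module_vec_simps)
  then interpret L: linear_map class_ring "module_vec TYPE('a) d" "module_vec TYPE('a) N" \<phi>
    unfolding linear_map_def using V.vectorspace_axioms W.vectorspace_axioms by blast
  have im: "L.im = ?C"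
    unfolding L.im_def by (simp add: module_vec_simps image)
  have inj: "inj_on \<phi> (carrier_vec d)"
  proof (rule inj_onI)
    fix x y assume xy: "x \<in> carrier_vec d" "y \<in> carrier_vec d" "\<phi> x = \<phi> y"
    have "\<phi> (x + (-1) \<cdot>\<^sub>v y) = \<phi> x + (-1) \<cdot>\<^sub>v \<phi> y" using xy by (simp add: add smult)
    also have "\<dots> = 0\<^sub>v N" using \<phi>_car[of y] xy(3) by (intro eq_vecI) auto
    finally have "Poly (list_of_vec (x + (-1) \<cdot>\<^sub>v y)) = 0"
      using xy by (intro inj) (auto simp: \<phi>_def polys_below_def coeff simp del: coeff_Poly_eq)
    hence "(if i < d then (x + (-1) \<cdot>\<^sub>v y) $ i else 0) = 0" for i
      using xy coeff[of "x + (-1) \<cdot>\<^sub>v y" i] by simp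
    hence "x $ i = y $ i" if "i < d" for i using that xy by (auto dest!: meta_spec[of _ i])
    thus "x = y" using xy by (intro eq_vecI) auto
  qed
  have sub: "VectorSpace.subspace class_ring ?C (module_vec TYPE('a) N)"
    using L.imT_is_subspace im by simp
  have "vectorspace.dim class_ring (module_vec TYPE('a) N\<lparr>carrier := L.im\<rparr>) +
        vectorspace.dim class_ring (module_vec TYPE('a) d\<lparr>carrier := L.ker\<rparr>) = V.dim"
    by (rule L.rank_nullity) (rule V.fin_dim)
  moreover have "vectorspace.dim class_ring (module_vec TYPE('a) d\<lparr>carrier := L.ker\<rparr>) = 0"
    by (rule L.inj_imp_dim_ker0) (simp add: module_vec_simps inj)
  ultimately have "dim_in N ?C = d"
    unfolding dim_in_def by (simp add: im V.dim_is_n)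
  with sub show ?thesis by (simp add: linear_code_def)
qed

text \<open>The points are those of the projective line, with \<open>None\<close> as the point at infinity.\<close>

definition eval_pt :: "nat \<Rightarrow> 'a::comm_ring_1 option \<Rightarrow> 'a poly \<Rightarrow> 'a" where
  "eval_pt k P f = (case P of None \<Rightarrow> coeff f (k - 1) | Some a \<Rightarrow> poly f a)"

text \<open>The extended generalized Reed-Solomon encoding with column multipliers \<open>w\<close>;
  the list fixes the order of the coordinates.\<close>

definition codeword :: "nat \<Rightarrow> ('a::comm_ring_1 option \<Rightarrow> 'a) \<Rightarrow> 'a option list \<Rightarrow> 'a poly \<Rightarrow> 'a vec" where
  "codeword k w xs f = vec (length xs) (\<lambda>i. w (xs ! i) * eval_pt k (xs ! i) f)"

definition vanishing_poly :: "'a::comm_ring_1 set \<Rightarrow> 'a poly" where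
  "vanishing_poly A = (\<Prod>a\<in>A. [:-a, 1:])"

section \<open>Polynomials with prescribed zeros on the projective line\<close>

lemma eval_pt_simps [simp]: 
  "eval_pt k None f = coeff f (k - 1)" "eval_pt k (Some a) f = poly f a"
  by (simp_all add: eval_pt_def)

lemma eval_pt_add: "eval_pt k P (f + g) = eval_pt k P f + eval_pt k P g"
  and eval_pt_diff: "eval_pt k P (f - g) = eval_pt k P f - eval_pt k P g"
  and eval_pt_smult: "eval_pt k P (Polynomial.smult c f) = c * eval_pt k P f"
  by (cases P; simp)+

lemma polys_below_iff: "f \<in> polys_below d \<longleftrightarrow> f = 0 \<or> degree f < d"
proof
  assume f: "f \<in> polys_below d"
  show "f = 0 \<or> degree f < d"
  proof (rule ccontr)
    assume "\<not> ?thesis"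
    hence "f \<noteq> 0" "coeff f (degree f) = 0" using f by (auto simp: polys_below_def)
    thus False by simp
  qed
qed (auto simp: polys_below_def coeff_eq_0)

lemma polys_below_diff: "f \<in> polys_below d \<Longrightarrow> g \<in> polys_below d \<Longrightarrow> f - g \<in> polys_below d"
  for f g :: "'a::ab_group_add poly"
  by (auto simp: polys_below_def)

lemma zero_in_polys_below [simp]: "0 \<in> polys_below d"
  by (auto simp: polys_below_def)

lemma poly_vanishing_poly_eq_0_iff:
  "finite A \<Longrightarrow> poly (vanishing_poly A) x = 0 \<longleftrightarrow> x \<in> A" for A :: "'a::idom set"
  by (auto simp: vanishing_poly_def poly_prod prod_zero_iff)

lemma degree_vanishing_poly: "degree (vanishing_poly A) = card A" for A :: "'a::idom set"
  by (simp add: vanishing_poly_def degree_prod_sum_eq)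

lemma lead_coeff_vanishing_poly: "lead_coeff (vanishing_poly A) = 1" for A :: "'a::idom set"
  by (simp add: vanishing_poly_def lead_coeff_prod)

lemma vanishing_poly_nonzero [simp]: "vanishing_poly A \<noteq> 0" for A :: "'a::idom set"
  using lead_coeff_vanishing_poly[of A] by auto

lemma vanishing_poly_dvd:
  fixes f :: "'a::idom poly"
  assumes "finite A" "\<And>a. a \<in> A \<Longrightarrow> poly f a = 0"
  shows "vanishing_poly A dvd f"
  using assms
proof (induction A arbitrary: f)
  case (insert a A)
  from insert.prems[of a] obtain g where g: "f = [:-a, 1:] * g"
    by (auto simp: poly_eq_0_iff_dvd elim: dvdE)
  have "poly g b = 0" if "b \<in> A" for b
    using insert.prems[of b] insert.hyps that by (auto simp: g)
  hence "vanishing_poly A dvd g" by (rule insert.IH)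
  thus ?case using insert.hyps by (simp add: vanishing_poly_def g mult_dvd_mono del: mult_pCons_left)
qed (simp add: vanishing_poly_def)

lemma card_option_set:
  assumes "finite X"
  shows "card X = card (Option.these X) + (if None \<in> X then 1 else 0)"
proof -
  have "X = Some ` Option.these X \<union> (X \<inter> {None})"
    by (auto simp: Option.these_def image_iff)
  moreover have "card (Some ` Option.these X \<union> (X \<inter> {None})) = card (Some ` Option.these X) + card (X \<inter> {None})"
    using assms by (intro card_Un_disjoint) (auto simp: Option.these_def)
  ultimately show ?thesis by (simp add: card_image)
qed

lemma finite_these: "finite X \<Longrightarrow> finite (Option.these X)"
  by (simp add: Option.these_def)

text \<open>A zero at infinity kills the coefficient of degree \<open>k - 1\<close>, which lowers
  the bound on the number of finite roots by one.\<close>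

lemma card_eval_pt_zeros:
  fixes f :: "'a::idom poly"
  assumes f: "f \<in> polys_below k" "f \<noteq> 0" and X: "finite X" "\<And>P. P \<in> X \<Longrightarrow> eval_pt k P f = 0"
  shows "card X < k"
proof -
  have "Option.these X \<subseteq> {x. poly f x = 0}"
    using X(2) by (fastforce simp: in_these_eq)
  hence "card (Option.these X) \<le> card {x. poly f x = 0}"
    using f by (intro card_mono poly_roots_finite) auto
  also have "\<dots> \<le> degree f" using f by (intro card_poly_roots_bound)
  finally have le: "card (Option.these X) \<le> degree f" .
  have deg: "degree f < k" using f by (simp add: polys_below_iff)
  have "degree f \<noteq> k - 1" if "None \<in> X"
    using X(2)[OF that] f(2) by (metis eval_pt_simps(1) leading_coeff_0_iff)
  with le deg show ?thesis using card_option_set[OF X(1)] by (auto split: if_splits)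
qed

text \<open>Zeros at finite points amount to divisibility by their vanishing polynomial, and a zero
  at infinity costs one more degree; each point takes away one dimension.\<close>

lemma vanishing_polys_below:
  fixes X :: "'a::idom option set"
  assumes X: "finite X" "card X \<le> k"
  shows "{f \<in> polys_below k. \<forall>P\<in>X. eval_pt k P f = 0} =
         (\<lambda>g. g * vanishing_poly (Option.these X)) ` polys_below (k - card X)"
    (is "?L = (\<lambda>g. g * ?D) ` _")
proof (intro equalityI subsetI)
  note card = card_option_set[OF X(1)]
  fix f assume "f \<in> (\<lambda>g. g * ?D) ` polys_below (k - card X)"
  then obtain g where g: "g \<in> polys_below (k - card X)" "f = g * ?D" by auto
  show "f \<in> ?L"
  proof (cases "g = 0")
    case True
    have "eval_pt k P 0 = 0" for P :: "'a option" by (cases P) auto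
    thus ?thesis using g True by simp
  next
    case False
    hence deg: "degree f = degree g + card (Option.these X)"
      by (simp add: g degree_mult_eq degree_vanishing_poly)
    have "eval_pt k P f = 0" if "P \<in> X" for P
    proof (cases P)
      case None
      thus ?thesis using False g deg card that by (auto simp: polys_below_iff intro!: coeff_eq_0)
    next
      case (Some a)
      thus ?thesis using that X by (simp add: g poly_vanishing_poly_eq_0_iff finite_these in_these_eq)
    qed
    moreover have "f \<in> polys_below k"
      using False g deg card by (auto simp: polys_below_iff)
    ultimately show ?thesis by auto
  qed
next
  note card = card_option_set[OF X(1)]
  fix f assume f: "f \<in> ?L"
  show "f \<in> (\<lambda>g. g * ?D) ` polys_below (k - card X)"
  proof (cases "f = 0")
    case True
    thus ?thesis by (auto intro!: image_eqI[of _ _ 0])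
  next
    case False
    have "?D dvd f" using f X by (intro vanishing_poly_dvd finite_these) (auto simp: in_these_eq)
    then obtain g where g: "f = g * ?D" by (auto elim!: dvdE simp: mult.commute)
    with False have "g \<noteq> 0" by auto
    hence deg: "degree f = degree g + card (Option.these X)"
      by (simp add: g degree_mult_eq degree_vanishing_poly)
    have "coeff f (k - 1) = 0" if "None \<in> X"
      using f that by (auto dest!: bspec[of X _ None])
    with False have "degree f \<noteq> k - 1" if "None \<in> X"
      using that by (metis leading_coeff_0_iff)
    hence "g \<in> polys_below (k - card X)"
      using f False deg card by (auto simp: polys_below_iff)
    thus ?thesis using g by auto
  qed
qed

text \<open>Evaluations at no more than \<open>k\<close> points are independent. The hull
  computation uses \<open>g\<close> as a test polynomial that isolates one point.\<close>

lemma ex_poly_separating_point: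
  fixes X :: "'a::idom option set"
  assumes X: "finite X" "card X \<le> k" "P \<in> X"
  obtains g where "g \<in> polys_below k" "eval_pt k P g \<noteq> 0" "\<And>R. R \<in> X - {P} \<Longrightarrow> eval_pt k R g = 0"
proof -
  let ?D = "vanishing_poly (Option.these (X - {P}))"
  have c: "card (X - {P}) = card X - 1" "card X > 0" using X card_gt_0_iff by auto
  \<comment> \<open>At infinity the value must be nonzero, so the monomial pads the product to
    degree exactly \<open>k - 1\<close>.\<close>
  define h :: "'a poly" where "h = (if P = None then monom 1 (k - card X) else 1)"
  have "h \<in> polys_below (k - card (X - {P}))"
    using c X by (auto simp: h_def polys_below_iff degree_monom_eq)
  hence 1: "h * ?D \<in> {f \<in> polys_below k. \<forall>R\<in>X - {P}. eval_pt k R f = 0}"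
    using X c by (subst vanishing_polys_below) auto
  have "eval_pt k P (h * ?D) \<noteq> 0"
  proof (cases P)
    case None
    have "degree (h * ?D) = k - card X + card (Option.these (X - {P}))"
      using None by (simp add: h_def degree_mult_eq degree_vanishing_poly degree_monom_eq monom_eq_0_iff)
    also have "\<dots> = k - 1" using card_option_set[of "X - {P}"] X c None by auto
    finally show ?thesis
      using None by (metis eval_pt_simps(1) h_def leading_coeff_0_iff monom_eq_0_iff mult_eq_0_iff
          one_neq_zero vanishing_poly_nonzero)
  next
    case (Some a)
    thus ?thesis using X
      by (simp add: h_def poly_vanishing_poly_eq_0_iff finite_these in_these_eq)
  qed
  with 1 show ?thesis by (intro that[of "h * ?D"]) auto
qed

section \<open>Codewords, minimum distance and Galois hull\<close>

lemma codeword_carrier [simp]: "codeword k w xs f \<in> carrier_vec (length xs)"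
  by (simp add: codeword_def)

lemma codeword_add: "codeword k w xs (f + g) = codeword k w xs f + codeword k w xs g"
  by (intro eq_vecI) (auto simp: codeword_def eval_pt_add algebra_simps)

lemma codeword_smult: "codeword k w xs (Polynomial.smult c f) = c \<cdot>\<^sub>v codeword k w xs f"
  by (intro eq_vecI) (auto simp: codeword_def eval_pt_smult)

lemma codeword_eq_zero:
  fixes f :: "'a::idom poly"
  assumes "distinct xs" "\<And>P. P \<in> set xs \<Longrightarrow> w P \<noteq> 0" "k \<le> length xs"
    and f: "f \<in> polys_below k" "codeword k w xs f = 0\<^sub>v (length xs)"
  shows "f = 0"
proof (rule ccontr)
  assume "f \<noteq> 0"
  have "eval_pt k P f = 0" if P: "P \<in> set xs" for P
  proof -
    obtain i where i: "i < length xs" "xs ! i = P" using P by (auto simp: in_set_conv_nth)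
    hence "codeword k w xs f $ i = 0" using f by simp
    thus ?thesis using assms(2)[OF P] i by (simp add: codeword_def)
  qed
  from card_eval_pt_zeros[OF f(1) \<open>f \<noteq> 0\<close> _ this] have "card (set xs) < k" by auto
  thus False using assms by (simp add: distinct_card)
qed

lemma hamming_dist_codeword:
  fixes f g :: "'a::idom poly"
  assumes "distinct xs" "\<And>P. P \<in> set xs \<Longrightarrow> w P \<noteq> 0"
  shows "hamming_dist (codeword k w xs f) (codeword k w xs g) =
         length xs - card {P \<in> set xs. eval_pt k P (f - g) = 0}"
proof -
  let ?Z = "{P \<in> set xs. eval_pt k P (f - g) = 0}"
  have "hamming_dist (codeword k w xs f) (codeword k w xs g) =
        card {i \<in> {..<length xs}. xs ! i \<in> set xs - ?Z}"
    unfolding hamming_dist_def codeword_def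
    by (rule arg_cong[where f = card]) (use assms(2) in \<open>auto simp: eval_pt_diff\<close>)
  also have "\<dots> = card ((!) xs ` {i \<in> {..<length xs}. xs ! i \<in> set xs - ?Z})"
    using assms(1) by (intro card_image[symmetric]) (auto simp: inj_on_def nth_eq_iff_index_eq)
  also have "(!) xs ` {i \<in> {..<length xs}. xs ! i \<in> set xs - ?Z} = set xs - ?Z"
  proof (intro equalityI subsetI)
    fix P assume "P \<in> set xs - ?Z"
    moreover from this obtain i where "i < length xs" "xs ! i = P"
      by (auto simp: in_set_conv_nth)
    ultimately show "P \<in> (!) xs ` {i \<in> {..<length xs}. xs ! i \<in> set xs - ?Z}" by blast
  qed blast
  also have "card \<dots> = length xs - card ?Z"
    using assms(1) by (subst card_Diff_subset) (auto simp: distinct_card)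
  finally show ?thesis .
qed

text \<open>Distinct codewords differ by a nonzero polynomial with at most \<open>k - 1\<close>
  projective zeros, and a product of \<open>k - 1\<close> distinct linear factors attains this
  bound.\<close>

lemma MDS_code_codewords:
  fixes w :: "'a::field option \<Rightarrow> 'a"
  assumes xs: "distinct xs" and w: "\<And>P. P \<in> set xs \<Longrightarrow> w P \<noteq> 0" and k: "1 \<le> k" "k \<le> length xs"
  shows "MDS_code (length xs) k (codeword k w xs ` polys_below k)"
proof -
  let ?T = "codeword k w xs" and ?N = "length xs"
  have lin: "linear_code ?N k (?T ` polys_below k)"
    using codeword_eq_zero[OF xs w] k
    by (intro linear_code_image_polys_below codeword_add codeword_smult codeword_carrier) auto
  let ?H = "{hamming_dist x y |x y. x \<in> ?T ` polys_below k \<and> y \<in> ?T ` polys_below k \<and> x \<noteq> y}"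
  have "Min ?H = ?N - (k - 1)"
  proof (rule Min_eqI)
    have "?H \<subseteq> {..?N}" by (auto simp: hamming_dist_codeword[OF xs w])
    thus "finite ?H" by (rule finite_subset) auto
  next
    fix n assume "n \<in> ?H"
    then obtain f g where fg: "f \<in> polys_below k" "g \<in> polys_below k" "?T f \<noteq> ?T g"
      "n = hamming_dist (?T f) (?T g)" by auto
    hence "f - g \<noteq> 0" by auto
    hence "card {P \<in> set xs. eval_pt k P (f - g) = 0} < k"
      using fg by (intro card_eval_pt_zeros[of "f - g"] polys_below_diff) auto
    thus "?N - (k - 1) \<le> n"
      using fg(4) k by (simp add: hamming_dist_codeword[OF xs w])
  next
    \<comment> \<open>Infinity takes up at most one coordinate, so \<open>k - 1\<close> finite
      points remain.\<close>
    have "k - 1 \<le> card (Option.these (set xs))"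
      using card_option_set[of "set xs"] k distinct_card[OF xs] by (auto split: if_splits)
    then obtain A where A: "A \<subseteq> Option.these (set xs)" "card A = k - 1"
      by (meson obtain_subset_with_card_n)
    have fin: "finite A" using A(1) finite_subset finite_these by blast
    define f where "f = vanishing_poly A"
    have deg: "degree f = k - 1" "f \<noteq> 0" by (auto simp: f_def degree_vanishing_poly A)
    have f: "f \<in> polys_below k" using deg k by (simp add: polys_below_iff)
    \<comment> \<open>Having degree exactly \<open>k - 1\<close>, \<open>f\<close> does not vanish
      at infinity, so its zeros are only those in \<open>A\<close>.\<close>
    have "coeff f (k - 1) \<noteq> 0" using deg by (metis leading_coeff_0_iff)
    hence "eval_pt k P f = 0 \<longleftrightarrow> P \<in> Some ` A" for P
      using fin by (cases P) (auto simp: f_def poly_vanishing_poly_eq_0_iff)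
    hence "{P \<in> set xs. eval_pt k P (f - 0) = 0} = Some ` A"
      using A by (auto simp: in_these_eq)
    hence "hamming_dist (?T f) (?T 0) = ?N - (k - 1)"
      by (simp only: hamming_dist_codeword[OF xs w] A card_image inj_Some)
    moreover have "?T f \<noteq> ?T 0"
    proof
      assume "?T f = ?T 0"
      also have "?T 0 = 0 \<cdot>\<^sub>v ?T 0" using codeword_smult[of k w xs 0 0] by simp
      also have "\<dots> = 0\<^sub>v ?N" by (intro eq_vecI) (auto simp: codeword_def)
      finally show False using codeword_eq_zero[OF xs w k(2) f] deg by auto
    qed
    ultimately show "?N - (k - 1) \<in> ?H"
      using f by (intro CollectI exI[of _ "?T f"] exI[of _ "?T 0"]) simp
  qed
  with lin k show ?thesis by (simp add: MDS_code_def min_dist_def)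
qed

lemma galois_form_codeword:
  assumes "distinct xs"
  shows "galois_form p l (codeword k w xs g) (codeword k w xs f) =
         (\<Sum>P\<in>set xs. w P ^ (p ^ l + 1) * eval_pt k P g * eval_pt k P f ^ (p ^ l))"
proof -
  have "galois_form p l (codeword k w xs g) (codeword k w xs f) =
        (\<Sum>i<length xs. w (xs ! i) ^ (p ^ l + 1) * eval_pt k (xs ! i) g * eval_pt k (xs ! i) f ^ (p ^ l))"
    unfolding galois_form_def codeword_def
    by (intro sum.cong) (auto simp: power_mult_distrib algebra_simps)
  also have "\<dots> = (\<Sum>P\<in>set xs. w P ^ (p ^ l + 1) * eval_pt k P g * eval_pt k P f ^ (p ^ l))"
    using sum.reindex_bij_betw[OF bij_betw_nth[OF assms refl refl],
        of "\<lambda>P. w P ^ (p ^ l + 1) * eval_pt k P g * eval_pt k P f ^ (p ^ l)"]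
    by simp
  finally show ?thesis .
qed

text \<open>On the code the Galois form is diagonal with nonzero weights on \<open>X\<close>.
  Testing against a polynomial that isolates one point of \<open>X\<close> forces a zero there, so
  the hull comes exactly from the polynomials vanishing on \<open>X\<close>.\<close>

lemma dim_galois_hull_codewords:
  fixes w :: "'a::field option \<Rightarrow> 'a"
  assumes xs: "distinct xs" and w: "\<And>P. P \<in> set xs \<Longrightarrow> w P \<noteq> 0" and k: "k \<le> length xs"
    and p: "p > 0"
    and X: "finite X" "card X \<le> k" "\<And>P. P \<in> X \<Longrightarrow> d P \<noteq> 0"
    and form: "\<And>f g. f \<in> polys_below k \<Longrightarrow> g \<in> polys_below k \<Longrightarrow>
       (\<Sum>P\<in>set xs. w P ^ (p ^ l + 1) * eval_pt k P g * eval_pt k P f ^ (p ^ l)) =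
       (\<Sum>P\<in>X. d P * eval_pt k P g * eval_pt k P f ^ (p ^ l))"
  shows "dim_in (length xs) (galois_hull p l (length xs) (codeword k w xs ` polys_below k)) = k - card X"
proof -
  let ?T = "codeword k w xs" and ?N = "length xs"
  let ?D = "vanishing_poly (Option.these X)"
  have "galois_hull p l ?N (?T ` polys_below k) = ?T ` {f \<in> polys_below k. \<forall>P\<in>X. eval_pt k P f = 0}"
  proof (intro equalityI subsetI)
    fix x assume "x \<in> galois_hull p l ?N (?T ` polys_below k)"
    then obtain f where f: "f \<in> polys_below k" "x = ?T f"
      and orth: "\<And>g. g \<in> polys_below k \<Longrightarrow> galois_form p l (?T g) (?T f) = 0"
      by (auto simp: galois_hull_def galois_dual_def)
    have "eval_pt k P f = 0" if P: "P \<in> X" for P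
    proof -
      obtain g where g: "g \<in> polys_below k" "eval_pt k P g \<noteq> 0"
        "\<And>R. R \<in> X - {P} \<Longrightarrow> eval_pt k R g = 0"
        using ex_poly_separating_point[OF X(1,2) P] by blast
      have "0 = (\<Sum>R\<in>X. d R * eval_pt k R g * eval_pt k R f ^ (p ^ l))"
        using orth[OF g(1)] form[OF f(1) g(1)] by (simp add: galois_form_codeword[OF xs])
      also have "\<dots> = (\<Sum>R\<in>{P}. d R * eval_pt k R g * eval_pt k R f ^ (p ^ l))"
        using X P g by (intro sum.mono_neutral_right) auto
      finally show ?thesis using X(3)[OF P] g(2) by auto
    qed
    thus "x \<in> ?T ` {f \<in> polys_below k. \<forall>P\<in>X. eval_pt k P f = 0}" using f by auto
  next
    fix x assume "x \<in> ?T ` {f \<in> polys_below k. \<forall>P\<in>X. eval_pt k P f = 0}"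
    then obtain f where f: "f \<in> polys_below k" "x = ?T f" "\<And>P. P \<in> X \<Longrightarrow> eval_pt k P f = 0" by auto
    have "galois_form p l (?T g) (?T f) = 0" if "g \<in> polys_below k" for g
      using form[OF f(1) that] f p by (simp add: galois_form_codeword[OF xs])
    thus "x \<in> galois_hull p l ?N (?T ` polys_below k)"
      using f by (auto simp: galois_hull_def galois_dual_def)
  qed
  also have "\<dots> = (\<lambda>g. ?T (g * ?D)) ` polys_below (k - card X)"
    by (simp add: vanishing_polys_below[OF X(1,2)] image_image)
  finally have hull: "galois_hull p l ?N (?T ` polys_below k) = \<dots>" .
  have "linear_code ?N (k - card X) ((\<lambda>g. ?T (g * ?D)) ` polys_below (k - card X))"
  proof (rule linear_code_image_polys_below)
    fix g assume g: "g \<in> polys_below (k - card X)" "?T (g * ?D) = 0\<^sub>v ?N"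
    hence "g * ?D \<in> polys_below k" using vanishing_polys_below[OF X(1,2)] by blast
    from codeword_eq_zero[OF xs w k this g(2)] show "g = 0" by simp
  qed (auto simp: distrib_right codeword_add codeword_smult)
  thus ?thesis unfolding hull linear_code_def by simp
qed

subsection \<open>Roots of unity in finite fields\<close>

lemma card_field_gt_1: "card (UNIV :: 'a::{finite,field} set) > 1"
proof -
  have "card {0, 1::'a} \<le> card (UNIV :: 'a set)" by (intro card_mono) auto
  thus ?thesis by simp
qed

text \<open>Multiplication by \<open>x\<close> permutes the nonzero elements and hence preserves
  their product, which can be cancelled.\<close>

lemma power_card_minus_1_eq_1:
  fixes x :: "'a::{finite,field}"
  assumes "x \<noteq> 0"
  shows "x ^ (card (UNIV :: 'a set) - 1) = 1"
proof -
  let ?S = "UNIV - {0::'a}"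
  have "bij_betw (\<lambda>y. x * y) ?S ?S"
    by (rule bij_betw_byWitness[of _ "\<lambda>y. y / x"]) (use assms in auto)
  hence "(\<Prod>y\<in>?S. x * y) = \<Prod>?S"
    by (rule prod.reindex_bij_betw)
  hence "x ^ card ?S * \<Prod>?S = 1 * \<Prod>?S"
    by (simp add: prod.distrib)
  moreover have "\<Prod>?S \<noteq> 0" by (simp add: prod_zero_iff)
  ultimately have "x ^ card ?S = 1" by (subst (asm) mult_cancel_right) auto
  thus ?thesis by (simp add: card_Diff_subset)
qed

lemma card_power_eq_le:
  fixes y :: "'a::idom"
  assumes "m > 0"
  shows "card {x. x ^ m = y} \<le> m" "finite {x. x ^ m = y}"
proof -
  let ?f = "monom 1 m - [:y:]"
  have "coeff ?f m = 1" using assms by (simp add: coeff_pCons split: nat.split)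
  hence nz: "?f \<noteq> 0" by (metis coeff_0 zero_neq_one)
  have "{x. x ^ m = y} = {x. poly ?f x = 0}" by (auto simp: poly_monom)
  moreover have "degree ?f \<le> m"
    by (intro degree_diff_le) (auto simp: degree_monom_eq)
  ultimately show "card {x. x ^ m = y} \<le> m" "finite {x. x ^ m = y}"
    using card_poly_roots_bound[OF nz] poly_roots_finite[OF nz] by auto
qed

text \<open>The \<open>d * m\<close> nonzero elements split into fibres of the \<open>m\<close>-th
  power over the \<open>d\<close>-th roots of unity. There are at most \<open>d\<close> fibres with
  at most \<open>m\<close> elements each, so both bounds are attained.\<close>

lemma roots_of_unity_finite_field:
  fixes y :: "'a::{finite,field}"
  assumes de: "d * m = card (UNIV :: 'a set) - 1"
  shows "card {y::'a. y ^ d = 1} = d"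
    and "y ^ d = 1 \<Longrightarrow> card {x. x ^ m = y} = m"
proof -
  let ?\<mu> = "{y::'a. y ^ d = 1}"
  have pos: "d > 0" "m > 0"
    using card_field_gt_1[where ?'a = 'a] de by (auto intro!: Nat.gr0I)
  have "UNIV - {0::'a} = (\<Union>y\<in>?\<mu>. {x. x ^ m = y})"
  proof (intro equalityI subsetI)
    fix x :: 'a assume "x \<in> UNIV - {0}"
    hence "x ^ (m * d) = 1" using power_card_minus_1_eq_1[of x] de by (simp add: mult.commute)
    thus "x \<in> (\<Union>y\<in>?\<mu>. {x. x ^ m = y})" by (simp add: power_mult)
  qed (use pos in \<open>auto simp: zero_power\<close>)
  hence "card (UNIV - {0::'a}) = (\<Sum>y\<in>?\<mu>. card {x. x ^ m = y})"
    by (simp only:, subst card_UN_disjoint) auto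
  moreover have "card (UNIV - {0::'a}) = d * m" using de by (simp add: card_Diff_subset)
  ultimately have sum: "d * m = (\<Sum>y\<in>?\<mu>. card {x. x ^ m = y})" by simp
  also have "\<dots> \<le> card ?\<mu> * m"
    using sum_bounded_above[of ?\<mu> "\<lambda>y. card {x. x ^ m = y}" m, OF card_power_eq_le(1)[OF pos(2)]]
    by simp
  finally have "d \<le> card ?\<mu>" using pos by simp
  thus card: "card ?\<mu> = d" using card_power_eq_le(1)[OF pos(1), of 1] by (intro antisym)
  show "card {x. x ^ m = y} = m" if "y ^ d = 1"
  proof (rule ccontr)
    assume "card {x. x ^ m = y} \<noteq> m"
    hence "card {x. x ^ m = y} < m" using card_power_eq_le(1)[OF pos(2), of y] by simp
    hence "(\<Sum>y\<in>?\<mu>. card {x. x ^ m = y}) < (\<Sum>y\<in>?\<mu>. m)"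
      using that card_power_eq_le(1)[OF pos(2)] by (intro sum_strict_mono_ex1) auto
    thus False using sum card by simp
  qed
qed

corollary power_eq_1_imp_ex_root:
  fixes y :: "'a::{finite,field}"
  assumes "d * m = card (UNIV :: 'a set) - 1" "y ^ d = 1"
  obtains x where "x ^ m = y"
proof -
  have "m > 0" using card_field_gt_1[where ?'a = 'a] assms(1) by (auto intro!: Nat.gr0I)
  hence "{x. x ^ m = y} \<noteq> {}" 
    using roots_of_unity_finite_field(2)[OF assms] by force
  thus ?thesis using that by blast
qed

section \<open>Characteristic and divisibility\<close>

lemma CHAR_eq_of_card_prime_power:
  assumes "prime p" "card (UNIV :: 'a::{finite,field} set) = p ^ e"
  shows "CHAR('a) = p"
proof -
  \<comment> \<open>Translation by 1 permutes the field; comparing the sums shows that its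
    cardinality is zero in it.\<close>
  have "(\<Sum>x\<in>(UNIV::'a set). x + 1) = (\<Sum>x\<in>(UNIV::'a set). x)"
    by (rule sum.reindex_bij_witness[of _ "\<lambda>x. x - 1" "\<lambda>x. x + 1"]) auto
  hence "of_nat (p ^ e) = (0 :: 'a)" by (simp add: sum.distrib flip: assms(2))
  hence "of_nat p = (0 :: 'a)" by simp
  hence "CHAR('a) dvd p" by (simp add: of_nat_eq_0_iff_char_dvd)
  thus ?thesis using assms(1) by (metis CHAR_not_1' One_nat_def prime_nat_iff)
qed

lemma power_minus_1_dvd_power_minus_1:
  fixes a b e :: nat
  assumes "a > 0" "b dvd e"
  shows "a ^ b - 1 dvd a ^ e - 1"
proof -
  obtain c where c: "e = b * c" using assms(2) by auto
  have "x - 1 dvd x ^ c - 1" if "x > 0" for x :: nat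
  proof (induction c)
    case (Suc c)
    have "x ^ Suc c - 1 = x * (x ^ c - 1) + (x - 1)"
      using that by (simp add: diff_mult_distrib2)
    thus ?case using Suc by (metis dvd_add dvd_mult dvd_refl)
  qed simp
  from this[of "a ^ b"] assms(1) show ?thesis by (simp add: c power_mult)
qed

text \<open>If \<open>c\<close> divides both cofactors, then \<open>M / c\<close> is a common
  multiple of \<open>g1\<close> and \<open>g2\<close>, hence a multiple of \<open>M\<close>, which
  forces \<open>c = 1\<close>.\<close>

lemma coprime_cofactors:
  fixes M g1 g2 :: nat
  assumes "M > 0" "g1 dvd M" "g2 dvd M" "lcm g1 g2 = M"
  shows "coprime (M div g1) (M div g2)"
proof (rule coprimeI)
  fix c assume c: "c dvd M div g1" "c dvd M div g2"
  have "c * g1 dvd M" "c * g2 dvd M"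
    using c assms by (metis dvd_div_iff_mult dvd_0_left_iff neq0_conv mult.commute)+
  then obtain N where N: "M = c * N" by (meson dvdE dvd_mult_left)
  hence "c > 0" "N > 0" using assms(1) by auto
  hence "g1 dvd N" "g2 dvd N" using \<open>c * g1 dvd M\<close> \<open>c * g2 dvd M\<close> N by auto
  hence "M dvd N" using assms(4) by (metis lcm_least)
  hence "c * N \<le> N" using \<open>N > 0\<close> N by (auto dest: dvd_imp_le)
  thus "is_unit c" using \<open>c > 0\<close> \<open>N > 0\<close> by simp
qed

subsection \<open>Lagrange weights\<close>

lemma poly_pderiv_vanishing_poly:
  fixes B :: "'a::field set"
  assumes "finite B" "b \<in> B"
  shows "poly (pderiv (vanishing_poly B)) b = poly (vanishing_poly (B - {b})) b"
proof -
  have "pderiv (vanishing_poly B) = (\<Sum>a\<in>B. vanishing_poly (B - {a}))"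
    unfolding vanishing_poly_def by (subst pderiv_prod) (simp add: pderiv_pCons)
  hence "poly (pderiv (vanishing_poly B)) b = (\<Sum>a\<in>B. poly (vanishing_poly (B - {a})) b)"
    by (simp add: poly_sum)
  also have "\<dots> = (\<Sum>a\<in>{b}. poly (vanishing_poly (B - {a})) b)"
    using assms by (intro sum.mono_neutral_right) (auto simp: poly_vanishing_poly_eq_0_iff)
  finally show ?thesis by simp
qed

text \<open>The sum is the coefficient of degree \<open>card B - 1\<close> in the Lagrange
  interpolant of \<open>F\<close> on \<open>B\<close>. The interpolant is \<open>F\<close> itself,
  whose degree is smaller.\<close>

lemma sum_poly_over_pderiv_eq_0:
  fixes B :: "'a::field set"
  assumes B: "finite B" and deg: "degree F + 1 < card B"
  shows "(\<Sum>b\<in>B. poly F b / poly (pderiv (vanishing_poly B)) b) = 0"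
proof -
  define c where "c b = poly F b / poly (pderiv (vanishing_poly B)) b" for b
  define L where "L = (\<Sum>b\<in>B. Polynomial.smult (c b) (vanishing_poly (B - {b})))"
  have deg_van: "degree (vanishing_poly (B - {b})) = card B - 1" if "b \<in> B" for b
    using that B by (simp add: degree_vanishing_poly)
  have "poly L b = poly F b" if b: "b \<in> B" for b
  proof -
    have "poly L b = (\<Sum>a\<in>B. c a * poly (vanishing_poly (B - {a})) b)"
      by (simp add: L_def poly_sum)
    also have "\<dots> = (\<Sum>a\<in>{b}. c a * poly (vanishing_poly (B - {a})) b)"
      using B b by (intro sum.mono_neutral_right) (auto simp: poly_vanishing_poly_eq_0_iff)
    also have "\<dots> = poly F b"
      using B b by (simp add: c_def poly_pderiv_vanishing_poly poly_vanishing_poly_eq_0_iff)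
    finally show ?thesis .
  qed
  moreover have "degree L \<le> card B - 1"
    unfolding L_def using deg_van
    by (intro degree_sum_le[OF B]) (auto intro: order.trans[OF degree_smult_le])
  ultimately have "L = F"
    using deg by (intro poly_eqI_degree[of B]) auto
  hence "0 = coeff L (card B - 1)" using deg by (simp add: coeff_eq_0)
  also have "\<dots> = (\<Sum>b\<in>B. c b * coeff (vanishing_poly (B - {b})) (card B - 1))"
    by (simp add: L_def coeff_sum)
  also have "\<dots> = (\<Sum>b\<in>B. c b)"
    by (intro sum.cong refl) (metis deg_van lead_coeff_vanishing_poly mult.right_neutral)
  finally show ?thesis by (simp add: c_def)
qed

text \<open>\<open>Q\<close> is the set of evaluation points and \<open>X\<close> the set where the
  weights deviate from the Lagrange weights. An omitted point of \<open>B\<close> deviates because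
  its weight becomes 0, and infinity, once used, because its Lagrange weight is 0; any other points
  of \<open>X\<close> are free sign changes.\<close>

lemma ex_MDS_code_galois_hull:
  fixes B :: "'a::field set" and U :: "'a \<Rightarrow> 'a"
  assumes B: "finite B" and U: "\<And>b. b \<in> B \<Longrightarrow> U b \<noteq> 0" and two: "(2::'a) \<noteq> 0" and p: "p > 0"
    and norm: "\<And>b. b \<in> B \<Longrightarrow> \<exists>w. w ^ (p ^ l + 1) = U b" "\<And>b. b \<in> B \<Longrightarrow> \<exists>w. w ^ (p ^ l + 1) = - U b"
    and sum0: "\<And>F. degree F + 1 < card B \<Longrightarrow> (\<Sum>b\<in>B. U b * poly F b) = 0"
    and k: "1 \<le> k" "k \<le> card Q" "(k - 1) * (p ^ l + 1) + 1 < card B"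
    and QX: "Q \<subseteq> insert None (Some ` B)" "X \<subseteq> insert None (Some ` B)"
      "Some ` B - Q \<subseteq> X" "None \<in> Q \<longleftrightarrow> None \<in> X" "card X \<le> k"
  shows "\<exists>C :: 'a vec set. MDS_code (card Q) k C \<and> dim_in (card Q) (galois_hull p l (card Q) C) = k - card X"
proof -
  let ?Z = "insert None (Some ` B)"
  \<comment> \<open>The diagonal form with weights \<open>u\<close> is zero on \<open>polys_below k\<close>. The code realises the
      weights \<open>c\<close> on \<open>Q\<close> and \<open>0\<close> elsewhere, which differ from \<open>u\<close> exactly on \<open>X\<close>.\<close>
  define u where "u P = (case P of None \<Rightarrow> 0 | Some b \<Rightarrow> U b)" for P
  define c where "c P = (if P = None then 1 else if P \<in> X then - u P else u P)" for P
  have "\<exists>w. w ^ (p ^ l + 1) = c P" if "P \<in> ?Z" for P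
  proof (cases P)
    case None
    thus ?thesis by (intro exI[of _ 1]) (simp add: c_def)
  next
    case (Some b)
    thus ?thesis using that norm[of b] by (auto simp: c_def u_def)
  qed
  then obtain w where w: "\<And>P. P \<in> ?Z \<Longrightarrow> w P ^ (p ^ l + 1) = c P" by metis
  have c0: "c P \<noteq> 0" if "P \<in> ?Z" for P
    using that U by (auto simp: c_def u_def)
  have w0: "w P \<noteq> 0" if "P \<in> ?Z" for P
    using w[OF that] c0[OF that] by (auto simp: zero_power)
  \<comment> \<open>On \<open>X\<close> this is 1 at infinity, \<open>- U b\<close> at an omitted
    point and \<open>- 2 * U b\<close> at a sign change; the last is nonzero because 2 is.\<close>
  define d where "d P = (if P \<in> Q then c P else 0) - u P" for P
  have fin: "finite Q" "finite X" using B QX finite_subset by blast+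
  obtain xs where xs: "set xs = Q" "distinct xs" using finite_distinct_list[OF fin(1)] by auto
  hence len: "length xs = card Q" using distinct_card by fastforce
  have d0: "d P \<noteq> 0" if "P \<in> X" for P
  proof (cases P)
    case None
    thus ?thesis using that QX by (simp add: d_def c_def u_def)
  next
    case (Some b)
    hence "b \<in> B" using that QX by auto
    hence "U b \<noteq> 0" using U by auto
    hence "- U b - U b \<noteq> 0" using two by (metis diff_conv_add_uminus mult_2 mult_eq_0_iff neg_equal_0_iff_equal)
    thus ?thesis using Some that \<open>U b \<noteq> 0\<close> by (simp add: d_def c_def u_def)
  qed
  have dz: "d P = 0" if "P \<in> ?Z - X" for P
    using that QX by (auto simp: d_def c_def u_def)
  have form: "(\<Sum>P\<in>set xs. w P ^ (p ^ l + 1) * eval_pt k P g * eval_pt k P f ^ (p ^ l)) =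
       (\<Sum>P\<in>X. d P * eval_pt k P g * eval_pt k P f ^ (p ^ l))" (is "?l = ?r")
    if fg: "f \<in> polys_below k" "g \<in> polys_below k" for f g
  proof -
    define t where "t P = eval_pt k P g * eval_pt k P f ^ (p ^ l)" for P
    have "degree (g * f ^ (p ^ l)) \<le> degree g + degree f * p ^ l"
      using degree_power_le[of f "p ^ l"] degree_mult_le[of g "f ^ (p ^ l)"] by linarith
    also have "\<dots> \<le> (k - 1) + (k - 1) * p ^ l"
      using fg by (intro add_mono mult_right_mono) (auto simp: polys_below_iff)
    finally have "degree (g * f ^ (p ^ l)) + 1 < card B" using k(3) by simp
    \<comment> \<open>Infinity may be included in the sum since \<open>u None = 0\<close>.\<close>
    from sum0[OF this] have "(\<Sum>P\<in>?Z. u P * t P) = 0"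
      using B by (simp add: u_def sum.reindex t_def poly_power)
    moreover have "?l = (\<Sum>P\<in>?Z. (if P \<in> Q then c P else 0) * t P)"
      unfolding xs t_def using w QX B
      by (intro sum.mono_neutral_cong_left) (auto simp: mult.assoc)
    ultimately have "?l = (\<Sum>P\<in>?Z. d P * t P)"
      by (simp only: d_def left_diff_distrib sum_subtractf) simp
    also have "\<dots> = ?r"
      unfolding t_def using dz QX B
      by (intro sum.mono_neutral_cong_right) (auto simp: mult.assoc)
    finally show ?thesis .
  qed
  have "MDS_code (length xs) k (codeword k w xs ` polys_below k)"
    using xs len w0 QX k by (intro MDS_code_codewords) auto
  moreover have "dim_in (length xs) (galois_hull p l (length xs) (codeword k w xs ` polys_below k)) =
      k - card X"
    using xs len w0 QX k p fin d0 form
    by (intro dim_galois_hull_codewords[where d = d]) auto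
  ultimately show ?thesis unfolding len by blast
qed


section \<open>Derivative values fixed by the \<open>Q\<close>-th power\<close>

context
  fixes p l Q :: nat and ty :: "'a::field itself"
  assumes p: "prime p" and Q: "Q = p ^ l" and char: "CHAR('a) = p"
begin

lemma frobenius_add: "(x + y) ^ Q = x ^ Q + (y ^ Q :: 'a)"
  using p char Q by (intro freshmans_dream'[of _ l]) auto

lemma frobenius_diff: "(x - y) ^ Q = x ^ Q - (y ^ Q :: 'a)"
  using frobenius_add[of "x - y" y] by simp

lemma frobenius_sum: "(\<Sum>i\<in>A. f i) ^ Q = (\<Sum>i\<in>A. f i ^ Q :: 'a)"
  using p char Q by (intro freshmans_dream_sum'[of _ l]) auto

lemma frobenius_of_nat: "of_nat n ^ Q = (of_nat n :: 'a)"
proof (induction n)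
  case 0
  show ?case using p Q by (simp add: prime_gt_0_nat)
qed (simp add: frobenius_add)

text \<open>The vanishing polynomial is \<open>x\<close> times the product of the
  \<open>x ^ m - y\<close>. The factor \<open>x\<close> turns the \<open>b ^ (m - 1)\<close> of the
  derivative into \<open>b ^ m\<close>, so the value is built from \<open>b ^ m\<close>, the
  \<open>y\<close> in \<open>Y\<close> and integers, all fixed by the \<open>Q\<close>-th power
  although \<open>b\<close> may not be.\<close>

lemma poly_pderiv_vanishing_poly_in_subfield:
  fixes Y B :: "'a set"
  assumes m: "m > 0" and Y: "finite Y" "\<And>y. y \<in> Y \<Longrightarrow> y ^ Q = y"
    and B: "finite B" "\<And>b. b \<in> B \<longleftrightarrow> b = 0 \<or> b ^ m \<in> Y" "card B = 1 + m * card Y"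
    and b: "b \<in> B"
  shows "poly (pderiv (vanishing_poly B)) b ^ Q = poly (pderiv (vanishing_poly B)) b"
proof -
  define f where "f y = monom 1 m - [:y:]" for y :: 'a
  define h where "h = (\<Prod>y\<in>Y. f y)"
  have coeff_m: "coeff (f y) m = 1" for y
    using m by (simp add: f_def coeff_pCons split: nat.split)
  have "degree (f y) \<le> m" for y
    unfolding f_def by (intro degree_diff_le) (auto simp: degree_monom_eq)
  with coeff_m have deg_f: "degree (f y) = m" for y
    by (metis le_antisym le_degree zero_neq_one)
  have f0: "f y \<noteq> 0" for y using coeff_m[of y] by (metis coeff_0 zero_neq_one)
  have deg_h: "degree h = m * card Y"
    unfolding h_def by (subst degree_prod_sum_eq) (simp_all add: f0 deg_f)
  have lead_h: "lead_coeff h = 1"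
    unfolding h_def lead_coeff_prod by (simp add: deg_f coeff_m)
  hence h0: "h \<noteq> 0" by auto
  \<comment> \<open>Both sides are monic of degree \<open>card B\<close>, so agreement on
    \<open>B\<close> suffices.\<close>
  have "vanishing_poly B = pCons 0 h"
  proof (rule poly_eqI_degree_lead_coeff[of _ "card B" _ B])
    show "coeff (vanishing_poly B) (card B) = coeff (pCons 0 h) (card B)"
      using lead_coeff_vanishing_poly[of B] lead_h by (simp add: degree_vanishing_poly B(3) deg_h)
    show "degree (pCons 0 h) \<le> card B"
      using h0 by (simp add: B(3) deg_h)
    show "poly (vanishing_poly B) z = poly (pCons 0 h) z" if "z \<in> B" for z
    proof -
      have "poly (pCons 0 h) z = 0"
        using that B(2)[of z] Y(1) by (auto simp: h_def f_def poly_prod prod_zero_iff poly_monom)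
      thus ?thesis using that B(1) by (metis poly_vanishing_poly_eq_0_iff)
    qed
  qed (auto simp: degree_vanishing_poly)
  hence "pderiv (vanishing_poly B) = h + pCons 0 (\<Sum>y\<in>Y. (\<Prod>y'\<in>Y - {y}. f y') * monom (of_nat m) (m - 1))"
    by (simp add: pderiv_pCons h_def pderiv_prod f_def pderiv_diff pderiv_monom)
  also have "poly \<dots> b = (\<Prod>y\<in>Y. b ^ m - y) +
      b * (\<Sum>y\<in>Y. (\<Prod>y'\<in>Y - {y}. b ^ m - y') * (of_nat m * b ^ (m - 1)))"
    by (simp add: h_def f_def poly_prod poly_sum poly_monom)
  also have "\<dots> = (\<Prod>y\<in>Y. b ^ m - y) +
      of_nat m * b ^ m * (\<Sum>y\<in>Y. \<Prod>y'\<in>Y - {y}. b ^ m - y')"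
    using m by (simp add: sum_distrib_left sum_distrib_right power_eq_if[of b m] mult_ac)
  finally have eq: "poly (pderiv (vanishing_poly B)) b = \<dots>" .
  have "b ^ m = 0 \<or> b ^ m \<in> Y" using b B(2)[of b] m by (auto simp: zero_power)
  hence bm: "(b ^ m) ^ Q = b ^ m"
    using Y(2) p Q by (auto simp: zero_power prime_gt_0_nat)
  have "(\<Prod>y\<in>A. b ^ m - y) ^ Q = (\<Prod>y\<in>A. b ^ m - y)" if "A \<subseteq> Y" for A
    using that Y(2) by (simp add: prod_power_distrib frobenius_diff bm subset_iff)
  thus ?thesis
    unfolding eq by (simp add: frobenius_add frobenius_sum frobenius_of_nat power_mult_distrib bm)
qed

end

section \<open>The parameters and the three lengths\<close>

theorem theorem3:
  fixes p e q l x1 x2 r n k :: nat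
  assumes "prime p" and "odd p" and "e \<ge> 1" and "q = p ^ e"
    and "card (UNIV :: 'a::{finite, field} set) = q"
    and "l \<le> e - 1" and "2 * l dvd e"
    and "x1 > 0" and "x2 > 0"
    and "(q - 1) dvd lcm x1 x2"
    and "((q - 1) div (p ^ l - 1)) dvd x1"
    and "1 \<le> r" and "r \<le> (q - 1) div gcd x1 (q - 1)"
    and "n = r * (q - 1) div gcd x2 (q - 1)"
    and "1 \<le> k" and "k \<le> (p ^ l + n) div (p ^ l + 1)"
  shows "(\<forall>h \<le> k - 1. \<exists>C :: 'a vec set.
            MDS_code n k C \<and> dim_in n (galois_hull p l n C) = h) \<and>
         (\<forall>h \<le> k. \<exists>C :: 'a vec set.
            MDS_code (n + 1) k C \<and> dim_in (n + 1) (galois_hull p l (n + 1) C) = h) \<and>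
         (\<forall>h \<le> k - 1. \<exists>C :: 'a vec set.
            MDS_code (n + 2) k C \<and> dim_in (n + 2) (galois_hull p l (n + 2) C) = h)"
proof -
  define Q where "Q = p ^ l"
  define M where "M = card (UNIV :: 'a set) - 1"
  note assms = assms[folded Q_def]
  have q: "q - 1 = M" using assms by (simp add: M_def)
  have M: "M > 0" using card_field_gt_1[where ?'a = 'a] by (simp add: M_def)
  \<comment> \<open>For \<open>l = 0\<close> the divisibility \<open>2 * l dvd e\<close> would give
    \<open>e = 0\<close>.\<close>
  have l: "l > 0" using assms(3,7) by (auto intro!: Nat.gr0I)
  have p: "p > 2" using assms(1,2) prime_ge_2_nat[of p] by (cases "p = 2") auto
  have Q: "Q \<ge> 3" using l p self_le_power[of p l] by (simp add: Q_def)
  have char: "CHAR('a) = p"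
    using assms(1,4,5) by (intro CHAR_eq_of_card_prime_power) auto
  have two: "(2::'a) \<noteq> 0"
    using of_nat_eq_0_iff_char_dvd[where ?'a = 'a, of 2] char p by (auto dest: dvd_imp_le)

  define g1 where "g1 = gcd x1 M"
  define g2 where "g2 = gcd x2 M"
  define o1 where "o1 = M div g1"
  define m where "m = M div g2"
  have o1: "o1 * g1 = M" and m: "g2 * m = M"
    by (simp_all add: o1_def m_def g1_def g2_def)
  have pos: "o1 > 0" "m > 0" "g2 > 0" using M o1 m by (auto intro!: Nat.gr0I)
  \<comment> \<open>By distributivity this lcm is the gcd of \<open>M\<close> with
    \<open>lcm x1 x2\<close>, a multiple of \<open>M\<close>.\<close>
  have "lcm g1 g2 = M"
    using gcd_lcm_distrib[of M x1 x2] assms(10) q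
    by (simp add: g1_def g2_def gcd.commute gcd_proj1_if_dvd)
  hence "coprime o1 m"
    unfolding o1_def m_def using M by (intro coprime_cofactors) (auto simp: g1_def g2_def)
  moreover have "o1 dvd g2 * m" using o1 m by (metis dvd_triv_left)
  \<comment> \<open>Hence every \<open>o1\<close>-th root of unity is a \<open>g2\<close>-th root of
    unity and has exactly \<open>m\<close> different \<open>m\<close>-th roots.\<close>
  ultimately have o1_g2: "o1 dvd g2" by (simp add: coprime_dvd_mult_left_iff)

  have "(Q - 1) * (Q + 1) = p ^ (2 * l) - 1"
    by (simp add: Q_def algebra_simps power_mult power2_eq_square mult_2 power_add)
  also have "\<dots> dvd M"
    using assms(4,7) p q power_minus_1_dvd_power_minus_1[of p "2 * l" e] by simp
  finally obtain c where c: "M = (Q - 1) * ((Q + 1) * c)" by (metis dvdE mult.assoc)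
  \<comment> \<open>\<open>(Q + 1) * c\<close> is \<open>(q - 1) / (Q - 1)\<close>. It divides
    \<open>g1\<close>, and cancelling it from \<open>o1 * g1 = M\<close> leaves
    \<open>o1 dvd Q - 1\<close>.\<close>
  have "(Q + 1) * c dvd x1" using assms(11) Q unfolding q by (simp add: c)
  hence "(Q + 1) * c dvd g1" by (simp add: g1_def c)
  then obtain t where "g1 = ((Q + 1) * c) * t" by (elim dvdE)
  hence "((Q + 1) * c) * (o1 * t) = ((Q + 1) * c) * (Q - 1)"
    using o1 c by (simp only: mult_ac)
  moreover have "(Q + 1) * c \<noteq> 0" using M c by (intro notI) simp
  ultimately have "o1 * t = Q - 1" by (simp only: mult_cancel_left) simp
  hence o1_Q: "o1 dvd Q - 1" by (metis dvd_triv_left)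

  have in_subfield: "y ^ Q = y" if "y ^ o1 = 1" for y :: 'a
  proof -
    have "y ^ (Q - 1) = 1" using that o1_Q by (auto simp: power_mult elim!: dvdE)
    thus ?thesis using Q by (simp add: power_eq_if[of y Q])
  qed
  \<comment> \<open>A nonzero \<open>x\<close> of the subfield is a \<open>(Q - 1)\<close>-th root
    of unity, so it has a root \<open>z\<close> of order \<open>(Q + 1) * c\<close>, and
    \<open>z ^ c\<close> has norm \<open>x\<close>.\<close>
  have norm: "\<exists>w. w ^ (Q + 1) = x" if x: "x ^ Q = x" "x \<noteq> 0" for x :: 'a
  proof -
    have "x ^ (Q - 1) = 1" using x Q by (simp add: power_eq_if[of x Q])
    then obtain z where "z ^ ((Q + 1) * c) = x"
      using power_eq_1_imp_ex_root[of "Q - 1" "(Q + 1) * c" x] c M_def by metis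
    thus ?thesis by (intro exI[of _ "z ^ c"]) (metis mult.commute power_mult)
  qed

  have "r \<le> card {y::'a. y ^ o1 = 1}"
    using roots_of_unity_finite_field(1)[of o1 g1, where ?'a = 'a] o1 assms(13) q
    by (simp add: M_def o1_def g1_def)
  then obtain Y :: "'a set" where Y: "Y \<subseteq> {y. y ^ o1 = 1}" "card Y = r"
    by (meson obtain_subset_with_card_n)
  define A where "A = {a. a ^ m \<in> Y}"
  have "n = r * M div g2" using assms(14) q by (simp only: g2_def)
  also have "r * M = r * m * g2" by (simp flip: m)
  finally have n: "n = r * m" using pos by simp
  have "A = (\<Union>y\<in>Y. {x. x ^ m = y})" by (auto simp: A_def)
  also have "card \<dots> = (\<Sum>y\<in>Y. card {x. x ^ m = y})"
    by (rule card_UN_disjoint) auto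
  also have "\<dots> = (\<Sum>y\<in>Y. m)"
  proof (intro sum.cong refl)
    fix y assume "y \<in> Y"
    hence "y ^ g2 = 1" using Y o1_g2 by (auto simp: power_mult elim!: dvdE)
    thus "card {x. x ^ m = y} = m" using m M_def by (intro roots_of_unity_finite_field(2)) auto
  qed
  finally have card_A: "card A = n" using Y n by simp
  have "0 \<notin> A" using Y pos by (auto simp: A_def zero_power)
  define B where "B = insert 0 A"
  have card_B: "card B = 1 + n" using \<open>0 \<notin> A\<close> card_A by (simp add: B_def)
  define U where "U b = inverse (poly (pderiv (vanishing_poly B)) b)" for b
  have U_nz: "U b \<noteq> 0" if "b \<in> B" for b
    using that by (simp add: U_def poly_pderiv_vanishing_poly poly_vanishing_poly_eq_0_iff)
  have U_Q: "U b ^ Q = U b" if "b \<in> B" for b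
  proof -
    have "poly (pderiv (vanishing_poly B)) b ^ Q = poly (pderiv (vanishing_poly B)) b"
      using assms(1) Q_def char pos(2)
    proof (rule poly_pderiv_vanishing_poly_in_subfield[where Y = Y])
      show "y ^ Q = y" if "y \<in> Y" for y using in_subfield that Y by auto
    qed (use that card_B n Y in \<open>auto simp: B_def A_def\<close>)
    thus ?thesis by (simp add: U_def power_inverse)
  qed
  have neg_Q: "(- U b) ^ Q = - U b" if "b \<in> B" for b
    using frobenius_diff[OF assms(1) Q_def char, of 0 "U b"] U_Q[OF that] Q by simp

  \<comment> \<open>The bound on \<open>k\<close> says that \<open>g * f ^ Q\<close> has degree at
    most \<open>n - 1\<close>, which is \<open>card B - 2\<close>, as the vanishing sum
    requires.\<close>
  have "k * (Q + 1) \<le> Q + n"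
    using assms(16) by (simp add: less_eq_div_iff_mult_less_eq)
  hence kn: "(k - 1) * (Q + 1) + 1 \<le> n"
    using assms(15) by (cases k) auto
  moreover have "k - 1 \<le> (k - 1) * (Q + 1)" by simp
  ultimately have k_le: "k \<le> n" using assms(15) by linarith
  have codes: "\<exists>C :: 'a vec set. MDS_code N k C \<and> dim_in N (galois_hull p l N C) = h"
    if "P \<subseteq> insert None (Some ` B)" "X \<subseteq> insert None (Some ` B)" "Some ` B - P \<subseteq> X"
      "None \<in> P \<longleftrightarrow> None \<in> X" "card X + h = k" "card P = N" "N \<ge> n" for P X N h
  proof -
    have "\<exists>C :: 'a vec set. MDS_code (card P) k C \<and>
        dim_in (card P) (galois_hull p l (card P) C) = k - card X"
    proof (rule ex_MDS_code_galois_hull[where B = B and U = U])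
      show "(\<Sum>b\<in>B. U b * poly F b) = 0" if "degree F + 1 < card B" for F
        using sum_poly_over_pderiv_eq_0[of B F] that
        by (simp add: U_def divide_inverse mult.commute)
      show "\<exists>w. w ^ (p ^ l + 1) = U b" "\<exists>w. w ^ (p ^ l + 1) = - U b" if "b \<in> B" for b
        using that norm[of "U b"] norm[of "- U b"] U_Q neg_Q U_nz by (auto simp: Q_def)
      show "(k - 1) * (p ^ l + 1) + 1 < card B"
        using kn card_B by (simp add: Q_def)
    qed (use that U_nz two p assms(15) k_le in auto)
    thus ?thesis using that by (metis diff_add_inverse)
  qed
  show ?thesis
  proof (intro conjI allI impI)
    fix h assume h: "h \<le> k - 1"
    \<comment> \<open>Length \<open>n\<close>: the point 0 is omitted and thus forced into
      \<open>X\<close>, so \<open>k - 1 - h\<close> sign changes remain to be chosen in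
      \<open>A\<close>.\<close>
    have "k - 1 - h \<le> card A" using card_A k_le by simp
    then obtain S where S: "S \<subseteq> A" "card S = k - 1 - h"
      by (meson obtain_subset_with_card_n)
    have "card (Some ` insert 0 S) = Suc (k - 1 - h)"
      using S \<open>0 \<notin> A\<close> by (subst card_image) (auto simp: card_insert_if)
    thus "\<exists>C :: 'a vec set. MDS_code n k C \<and> dim_in n (galois_hull p l n C) = h"
      using S h assms(15) card_A
      by (intro codes[where P = "Some ` A" and X = "Some ` insert 0 S"])
         (auto simp: B_def card_image)
  next
    fix h assume h: "h \<le> k"
    \<comment> \<open>Length \<open>n + 1\<close>: nothing is forced into \<open>X\<close>, so
      \<open>h = k\<close> is reached with no sign change.\<close>
    have "k - h \<le> card B" using card_B k_le by simp
    then obtain S where S: "S \<subseteq> B" "card S = k - h"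
      by (meson obtain_subset_with_card_n)
    thus "\<exists>C :: 'a vec set. MDS_code (n + 1) k C \<and> dim_in (n + 1) (galois_hull p l (n + 1) C) = h"
      using h card_B
      by (intro codes[where P = "Some ` B" and X = "Some ` S"]) (auto simp: card_image)
  next
    fix h assume h: "h \<le> k - 1"
    \<comment> \<open>Length \<open>n + 2\<close>: infinity is added and forced into
      \<open>X\<close>, which again limits \<open>h\<close> to \<open>k - 1\<close>.\<close>
    have "k - 1 - h \<le> card B" using card_B k_le by simp
    then obtain S where S: "S \<subseteq> B" "card S = k - 1 - h"
      by (meson obtain_subset_with_card_n)
    thus "\<exists>C :: 'a vec set. MDS_code (n + 2) k C \<and> dim_in (n + 2) (galois_hull p l (n + 2) C) = h"
      using h card_B assms(15)
      by (intro codes[where P = "insert None (Some ` B)" and X = "insert None (Some ` S)"])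
         (auto simp: card_image card_insert_if)
  qed
qed

end
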